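(* Let $((V,\rho,\varphi),\alpha)$ be a representation of an averaging pre-Lie algebra $((A,\circ),P)$. Define linear maps $\rho^L,\rho^R:A\to\mathfrak{gl}(V)$ by $$\rho^L(x)=\rho(P(x))-\varphi(P(x)),\qquad \rho^R(x)(\xi)=-\rho(x)(\alpha(\xi))+\varphi(x)(\alpha(\xi)),\qquad x\in A,\ \xi\in V.$$ Then $(V;\rho^L,\rho^R)$ is a representation of the induced Leibniz algebra $A_P$.
   Context: All vector spaces are finite-dimensional over a fixed field $\mathbf k$ of characteristic $0$. A pre-Lie algebra $(A,\circ)$ is a vector space with a bilinear product satisfying $(x\circ y)\circ z-x\circ(y\circ z)=(y\circ x)\circ z-y\circ(x\circ z)$. An averaging operator is a linear $P:A\to A$ with $P(x)\circ P(y)=P(P(x)\circ y)=P(x\circ P(y))$; then $((A,\circ),P)$ is an averaging pre-Lie algebra. Its induced Leibniz algebra $A_P$ is the space $A$ with bracket $[x,y]_P=P(x)\circ y-y\circ P(x)$ (left Leibniz: $[[x,y],z]+[y,[x,z]]=[x,[y,z]]$). A representation of $(A,\circ)$ is $(V,\rho,\varphi)$ with linear $\rho,\varphi:A\to\mathrm{End}(V)$ such that $\rho(x\circ y-y\circ x)=\rho(x)\rho(y)-\rho(y)\rho(x)$ and $\varphi(x\circ y)=\rho(x)\varphi(y)-\varphi(y)\rho(x)+\varphi(y)\varphi(x)$. A representation of $((A,\circ),P)$ is $((V,\rho,\varphi),\alpha)$ with $(V,\rho,\varphi)$ a representation of $(A,\circ)$ and $\alpha:V\to V$ linear such that $\rho(P(x))\alpha(v)=\alpha(\rho(P(x))v)=\alpha(\rho(x)\alpha(v))$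 and $\varphi(P(x))\alpha(v)=\alpha(\varphi(P(x))v)=\alpha(\varphi(x)\alpha(v))$. A representation of a Leibniz algebra $(\mathcal G,[\cdot,\cdot])$ is $(W;\rho^L,\rho^R)$ with linear $\rho^L,\rho^R:\mathcal G\to\mathfrak{gl}(W)$ such that for all $x,y$: $\rho^L([x,y])=\rho^L(x)\rho^L(y)-\rho^L(y)\rho^L(x)$, $\rho^R([x,y])=\rho^L(x)\rho^R(y)-\rho^R(y)\rho^L(x)$, $\rho^R(y)\rho^L(x)=-\rho^R(y)\rho^R(x)$. *)

theory Defs
  imports Complex_Main
begin

text \<open>
  A vector space is a whole type equipped with a scalar multiplication by a field
  of characteristic zero. A linear map from \<open>A\<close> to \<open>End(V)\<close> is a curried function
  \<open>A \<Rightarrow> V \<Rightarrow> V\<close>; since the operations of \<open>End(V)\<close> are pointwise, such a map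
  is linear with values in \<open>End(V)\<close> iff the function is linear in each argument.
\<close>

locale fin_dim_space = vector_space scale
  for scale :: "'k::field_char_0 \<Rightarrow> 'a::ab_group_add \<Rightarrow> 'a" +
  assumes fin_dim: "\<exists>B. finite_dimensional_vector_space scale B"

definition bilinear_map ::
  "('k::field \<Rightarrow> 'a::ab_group_add \<Rightarrow> 'a) \<Rightarrow> ('k \<Rightarrow> 'b::ab_group_add \<Rightarrow> 'b) \<Rightarrow>
   ('k \<Rightarrow> 'c::ab_group_add \<Rightarrow> 'c) \<Rightarrow> ('a \<Rightarrow> 'b \<Rightarrow> 'c) \<Rightarrow> bool"
  where "bilinear_map sA sB sC f \<longleftrightarrow>
    (\<forall>x. Vector_Spaces.linear sB sC (f x)) \<and>
    (\<forall>y. Vector_Spaces.linear sA sC (\<lambda>x. f x y))"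

locale prelie_algebra = fin_dim_space scaleA
  for scaleA :: "'k::field_char_0 \<Rightarrow> 'a::ab_group_add \<Rightarrow> 'a" +
  fixes mult :: "'a \<Rightarrow> 'a \<Rightarrow> 'a"  (infixl \<open>\<bullet>\<close> 70)
  assumes bilinear_mult: "bilinear_map scaleA scaleA scaleA mult"
    and prelie_identity:
      "(x \<bullet> y) \<bullet> z - x \<bullet> (y \<bullet> z) = (y \<bullet> x) \<bullet> z - y \<bullet> (x \<bullet> z)"

locale averaging_prelie_algebra = prelie_algebra scaleA mult
  for scaleA :: "'k::field_char_0 \<Rightarrow> 'a::ab_group_add \<Rightarrow> 'a"
    and mult :: "'a \<Rightarrow> 'a \<Rightarrow> 'a"  (infixl \<open>\<bullet>\<close> 70) +
  fixes P :: "'a \<Rightarrow> 'a"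
  assumes linear_P: "Vector_Spaces.linear scaleA scaleA P"
    and averaging_left: "P x \<bullet> P y = P (P x \<bullet> y)"
    and averaging_right: "P (P x \<bullet> y) = P (x \<bullet> P y)"

locale prelie_representation = prelie_algebra scaleA mult + V: fin_dim_space scaleV
  for scaleA :: "'k::field_char_0 \<Rightarrow> 'a::ab_group_add \<Rightarrow> 'a"
    and mult :: "'a \<Rightarrow> 'a \<Rightarrow> 'a"  (infixl \<open>\<bullet>\<close> 70)
    and scaleV :: "'k \<Rightarrow> 'v::ab_group_add \<Rightarrow> 'v" +
  fixes \<rho> \<phi> :: "'a \<Rightarrow> 'v \<Rightarrow> 'v"
  assumes linear_\<rho>: "bilinear_map scaleA scaleV scaleV \<rho>"
    and linear_\<phi>: "bilinear_map scaleA scaleV scaleV \<phi>"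
    and \<rho>_commutator: "\<rho> (x \<bullet> y - y \<bullet> x) v = \<rho> x (\<rho> y v) - \<rho> y (\<rho> x v)"
    and \<phi>_mult: "\<phi> (x \<bullet> y) v = \<rho> x (\<phi> y v) - \<phi> y (\<rho> x v) + \<phi> y (\<phi> x v)"

locale averaging_prelie_representation =
  averaging_prelie_algebra scaleA mult P + prelie_representation scaleA mult scaleV \<rho> \<phi>
  for scaleA :: "'k::field_char_0 \<Rightarrow> 'a::ab_group_add \<Rightarrow> 'a"
    and mult :: "'a \<Rightarrow> 'a \<Rightarrow> 'a"  (infixl \<open>\<bullet>\<close> 70)
    and P :: "'a \<Rightarrow> 'a"
    and scaleV :: "'k \<Rightarrow> 'v::ab_group_add \<Rightarrow> 'v"
    and \<rho> \<phi> :: "'a \<Rightarrow> 'v \<Rightarrow> 'v" +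
  fixes \<alpha> :: "'v \<Rightarrow> 'v"
  assumes linear_\<alpha>: "Vector_Spaces.linear scaleV scaleV \<alpha>"
    and \<rho>_averaging_left: "\<rho> (P x) (\<alpha> v) = \<alpha> (\<rho> (P x) v)"
    and \<rho>_averaging_right: "\<alpha> (\<rho> (P x) v) = \<alpha> (\<rho> x (\<alpha> v))"
    and \<phi>_averaging_left: "\<phi> (P x) (\<alpha> v) = \<alpha> (\<phi> (P x) v)"
    and \<phi>_averaging_right: "\<alpha> (\<phi> (P x) v) = \<alpha> (\<phi> x (\<alpha> v))"

locale leibniz_algebra = fin_dim_space scaleG
  for scaleG :: "'k::field_char_0 \<Rightarrow> 'g::ab_group_add \<Rightarrow> 'g" +
  fixes bracket :: "'g \<Rightarrow> 'g \<Rightarrow> 'g"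
  assumes bilinear_bracket: "bilinear_map scaleG scaleG scaleG bracket"
    and left_leibniz:
      "bracket (bracket x y) z + bracket y (bracket x z) = bracket x (bracket y z)"

locale leibniz_representation = leibniz_algebra scaleG bracket + W: fin_dim_space scaleW
  for scaleG :: "'k::field_char_0 \<Rightarrow> 'g::ab_group_add \<Rightarrow> 'g"
    and bracket :: "'g \<Rightarrow> 'g \<Rightarrow> 'g"
    and scaleW :: "'k \<Rightarrow> 'w::ab_group_add \<Rightarrow> 'w" +
  fixes \<rho>L \<rho>R :: "'g \<Rightarrow> 'w \<Rightarrow> 'w"
  assumes linear_\<rho>L: "bilinear_map scaleG scaleW scaleW \<rho>L"
    and linear_\<rho>R: "bilinear_map scaleG scaleW scaleW \<rho>R"
    and \<rho>L_bracket: "\<rho>L (bracket x y) w = \<rho>L x (\<rho>L y w) - \<rho>L y (\<rho>L x w)"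
    and \<rho>R_bracket: "\<rho>R (bracket x y) w = \<rho>L x (\<rho>R y w) - \<rho>R y (\<rho>L x w)"
    and \<rho>R_\<rho>L: "\<rho>R y (\<rho>L x w) = - \<rho>R y (\<rho>R x w)"

definition induced_bracket :: "('a::ab_group_add \<Rightarrow> 'a \<Rightarrow> 'a) \<Rightarrow> ('a \<Rightarrow> 'a) \<Rightarrow> 'a \<Rightarrow> 'a \<Rightarrow> 'a"
  where "induced_bracket mult P x y = mult (P x) y - mult y (P x)"

end

theory Submission
  imports Defs
begin

text \<open>
  The difference \<open>D = \<rho> - \<phi>\<close> is a representation on \<open>V\<close> of the commutator Lie algebra of
  \<open>A\<close>. The averaging conditions say that \<open>P\<close> sends the induced bracket to the commutator of
  the images, and that \<open>D (P x) \<alpha> = \<alpha> D (P x) = \<alpha> D x \<alpha>\<close>. Since \<open>\<rho>\<^sup>L x = D (P x)\<close> and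
  \<open>\<rho>\<^sup>R x = - D x \<alpha>\<close>, the Leibniz axioms reduce to the Jacobi identity and to
  \<open>D\<close> being a Lie representation.
\<close>

lemma
  assumes "bilinear_map sA sB sC f"
  shows bilinear_map_diff_left: "f (x - y) z = f x z - f y z"
    and bilinear_map_diff_right: "f x (u - v) = f x u - f x v"
    and bilinear_map_minus_right: "f x (- u) = - f x u"
proof -
  have L: "module_hom sA sC (\<lambda>x. f x z)" for z
    using assms by (simp add: bilinear_map_def linear_iff_module_hom)
  have R: "module_hom sB sC (f x)" for x
    using assms by (simp add: bilinear_map_def linear_iff_module_hom)
  show "f (x - y) z = f x z - f y z"
    by (fact module_hom.diff[OF L])
  show "f x (u - v) = f x u - f x v" "f x (- u) = - f x u"
    by (fact module_hom.diff[OF R] module_hom.neg[OF R])+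
qed

lemma linear_diff:
  assumes "Vector_Spaces.linear s t f" "Vector_Spaces.linear s t g"
  shows "Vector_Spaces.linear s t (\<lambda>x. f x - g x)"
proof -
  interpret vector_space_pair s t
    using assms(1) by (simp add: vector_space_pair_def Vector_Spaces.linear_def)
  show ?thesis using assms by (rule linear_compose_sub)
qed

lemma bilinear_map_diff:
  assumes "bilinear_map sA sB sC f" "bilinear_map sA sB sC g"
  shows "bilinear_map sA sB sC (\<lambda>x y. f x y - g x y)"
  using assms by (simp add: bilinear_map_def linear_diff)

lemma bilinear_map_flip:
  "bilinear_map sA sB sC f \<Longrightarrow> bilinear_map sB sA sC (\<lambda>y x. f x y)"
  by (simp add: bilinear_map_def)

lemma bilinear_map_compose_left:
  assumes "bilinear_map sA sB sC f" "Vector_Spaces.linear sD sA h"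
  shows "bilinear_map sD sB sC (\<lambda>x. f (h x))"
  using assms Vector_Spaces.linear_compose[OF assms(2)]
  by (fastforce simp: bilinear_map_def comp_def)

lemma bilinear_map_compose_right:
  assumes "bilinear_map sA sB sC f" "Vector_Spaces.linear sD sB h"
  shows "bilinear_map sA sD sC (\<lambda>x y. f x (h y))"
  using bilinear_map_flip[OF bilinear_map_compose_left[OF bilinear_map_flip[OF assms(1)] assms(2)]] .

context prelie_algebra
begin

definition commutator :: "'a \<Rightarrow> 'a \<Rightarrow> 'a"
  where "commutator x y = x \<bullet> y - y \<bullet> x"

lemma bilinear_commutator: "bilinear_map scaleA scaleA scaleA commutator"
  unfolding commutator_def[abs_def]
  by (intro bilinear_map_diff bilinear_mult bilinear_map_flip[OF bilinear_mult])

text \<open>The pre-Lie identity makes the associator symmetric in its first two arguments, so the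
  associators cancel in the Jacobi sum.\<close>

lemma commutator_jacobi:
  "commutator (commutator x y) z + commutator y (commutator x z) = commutator x (commutator y z)"
proof -
  have swap: "(u \<bullet> v) \<bullet> w = (v \<bullet> u) \<bullet> w - v \<bullet> (u \<bullet> w) + u \<bullet> (v \<bullet> w)" for u v w
    using prelie_identity[of u v w] by (simp add: algebra_simps)
  show ?thesis
    unfolding commutator_def
    \<comment> \<open>The three cyclic instances of \<open>swap\<close> rewrite one product from
      each pair \<open>(u \<bullet> v) \<bullet> w\<close>,
      \<open>(v \<bullet> u) \<bullet> w\<close>; a general rule could swap back and forth.\<close>
    by (simp add: bilinear_map_diff_left[OF bilinear_mult] bilinear_map_diff_right[OF bilinear_mult]
        swap[of x y z] swap[of y z x] swap[of z x y])
qed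

end

context averaging_prelie_algebra
begin

lemma induced_bracket_eq: "induced_bracket mult P x y = commutator (P x) y"
  by (simp add: induced_bracket_def commutator_def)

text \<open>For the second term, \<open>P (y \<bullet> P x) = P (P y \<bullet> x) = P y \<bullet> P
  x\<close> uses both averaging laws.\<close>

lemma P_commutator: "P (commutator (P x) y) = commutator (P x) (P y)"
proof -
  have "P (commutator (P x) y) = P (P x \<bullet> y) - P (y \<bullet> P x)"
    using linear_P by (simp add: commutator_def linear_iff_module_hom module_hom.diff)
  then show ?thesis
    by (metis commutator_def averaging_left averaging_right)
qed

text \<open>By \<open>P_commutator\<close>, the left Leibniz identity is the Jacobi identity for
  \<open>P x\<close>, \<open>P y\<close>, \<open>z\<close>.\<close>

lemma leibniz_algebra_induced: "leibniz_algebra scaleA (induced_bracket mult P)"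
proof
  show "bilinear_map scaleA scaleA scaleA (induced_bracket mult P)"
    using bilinear_map_compose_left[OF bilinear_commutator linear_P]
    by (simp add: induced_bracket_eq[abs_def])
qed (simp add: induced_bracket_eq P_commutator commutator_jacobi)

end

context prelie_representation
begin

definition lie_action :: "'a \<Rightarrow> 'v \<Rightarrow> 'v"
  where "lie_action x v = \<rho> x v - \<phi> x v"

lemma bilinear_lie_action: "bilinear_map scaleA scaleV scaleV lie_action"
  unfolding lie_action_def[abs_def] by (intro bilinear_map_diff linear_\<rho> linear_\<phi>)

text \<open>Subtracting the law for \<phi> with \<open>x\<close> and \<open>y\<close> exchanged from
  the original one yields exactly the mixed terms and the \<phi>\<phi> terms of the expanded
  right-hand side.\<close>

lemma lie_action_commutator:
  "lie_action (commutator x y) v = lie_action x (lie_action y v) - lie_action y (lie_action x v)"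
  unfolding lie_action_def commutator_def
  by (simp add: \<rho>_commutator \<phi>_mult bilinear_map_diff_left[OF linear_\<phi>]
      bilinear_map_diff_right[OF linear_\<phi>] bilinear_map_diff_right[OF linear_\<rho>] algebra_simps)

end

context averaging_prelie_representation
begin

lemma \<alpha>_lie_action: "\<alpha> (lie_action (P x) v) = \<alpha> (lie_action x (\<alpha> v))"
  using linear_\<alpha>
  by (simp add: lie_action_def linear_iff_module_hom module_hom.diff
      \<rho>_averaging_right \<phi>_averaging_right)

lemma leibniz_representation_induced:
  "leibniz_representation scaleA (induced_bracket mult P) scaleV
    (\<lambda>x. lie_action (P x)) (\<lambda>x v. - lie_action x (\<alpha> v))"
proof -
  interpret leibniz_algebra scaleA "induced_bracket mult P"
    by (rule leibniz_algebra_induced)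
  \<comment> \<open>As a difference, the right action inherits bilinearity from
    \<open>bilinear_map_diff\<close>.\<close>
  have minus: "- lie_action x (\<alpha> v) = \<phi> x (\<alpha> v) - \<rho> x (\<alpha> v)" for x v
    by (simp add: lie_action_def)
  note D_minus = bilinear_map_minus_right[OF bilinear_lie_action]
  have \<alpha>_minus: "\<alpha> (- v) = - \<alpha> v" for v
    using linear_\<alpha> by (simp add: linear_iff_module_hom module_hom.neg)
  show ?thesis
  proof
    show "bilinear_map scaleA scaleV scaleV (\<lambda>x. lie_action (P x))"
      using bilinear_lie_action linear_P by (rule bilinear_map_compose_left)
    show "bilinear_map scaleA scaleV scaleV (\<lambda>x v. - lie_action x (\<alpha> v))"
      unfolding minus
      by (intro bilinear_map_diff bilinear_map_compose_right[OF linear_\<rho> linear_\<alpha>]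
          bilinear_map_compose_right[OF linear_\<phi> linear_\<alpha>])
  next
    fix x y v
    show "lie_action (P (induced_bracket mult P x y)) v =
        lie_action (P x) (lie_action (P y) v) - lie_action (P y) (lie_action (P x) v)"
      by (simp add: induced_bracket_eq P_commutator lie_action_commutator)
    \<comment> \<open>With \<alpha> moved past the action of \<open>P x\<close>, the second axiom
      becomes \<open>lie_action_commutator\<close> for \<open>P x\<close> and \<open>y\<close>,
      applied to \<open>\<alpha> v\<close> and negated.\<close>
    have "\<alpha> (lie_action (P x) v) = lie_action (P x) (\<alpha> v)"
      using linear_\<alpha>
      by (simp add: lie_action_def linear_iff_module_hom module_hom.diff
          \<rho>_averaging_left \<phi>_averaging_left)
    then show "- lie_action (induced_bracket mult P x y) (\<alpha> v) =
        lie_action (P x) (- lie_action y (\<alpha> v)) - (- lie_action y (\<alpha> (lie_action (P x) v)))"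
      by (simp add: induced_bracket_eq lie_action_commutator D_minus)
    \<comment> \<open>Both sides equal
      \<open>- lie_action y (\<alpha> (lie_action x (\<alpha> v)))\<close>: the left by
      \<open>\<alpha>_lie_action\<close>, the right by pulling out the inner sign.\<close>
    show "- lie_action y (\<alpha> (lie_action (P x) v)) =
        - (- lie_action y (\<alpha> (- lie_action x (\<alpha> v))))"
      by (simp add: \<alpha>_lie_action D_minus \<alpha>_minus)
  qed
qed

end

theorem proposition2p17:
  fixes scaleA :: "'k::field_char_0 \<Rightarrow> 'a::ab_group_add \<Rightarrow> 'a"
    and mult :: "'a \<Rightarrow> 'a \<Rightarrow> 'a"
    and P :: "'a \<Rightarrow> 'a"
    and scaleV :: "'k \<Rightarrow> 'v::ab_group_add \<Rightarrow> 'v"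
    and \<rho> \<phi> :: "'a \<Rightarrow> 'v \<Rightarrow> 'v"
    and \<alpha> :: "'v \<Rightarrow> 'v"
  assumes "averaging_prelie_representation scaleA mult P scaleV \<rho> \<phi> \<alpha>"
  shows "leibniz_representation scaleA (induced_bracket mult P) scaleV
    (\<lambda>x \<xi>. \<rho> (P x) \<xi> - \<phi> (P x) \<xi>)
    (\<lambda>x \<xi>. - \<rho> x (\<alpha> \<xi>) + \<phi> x (\<alpha> \<xi>))"
proof -
  interpret averaging_prelie_representation scaleA mult P scaleV \<rho> \<phi> \<alpha>
    by (fact assms)
  show ?thesis
    using leibniz_representation_induced by (simp add: lie_action_def[abs_def])
qed

end
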